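(* If $G$ is a nonempty graph (that is, a graph with at least one vertex), then there exists a vertex $v$ of $G$ such that $\mathrm{avi}(G-v)<\mathrm{avi}(G)$.
   Context: All graphs are finite and simple. For a graph $G$, an independent set is a set of pairwise non-adjacent vertices (the empty set is independent). $\mathrm{avi}(G)$ denotes the average size of independent sets of $G$: $\mathrm{avi}(G)=\mathrm{T}(G)/\mathrm{I}(G)$, where $\mathrm{I}(G)$ is the number of independent sets of $G$ and $\mathrm{T}(G)$ is the sum of the cardinalities of all independent sets of $G$. For the graph with no vertices, the only independent set is the empty set, so $\mathrm{avi}=0$. $G-v$ is the graph obtained from $G$ by deleting the vertex $v$ and all edges incident to it. *)

theory Defs
  imports Complex_Main "Graph_Theory.Digraph"
begin

text \<open>
  Finite simple graphs are the locale \<^locale>\<open>graph\<close>: each undirected edge is represented by its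
  two opposite arcs, so adjacency of \<open>u\<close> and \<open>v\<close> is \<open>u \<rightarrow>\<^bsub>G\<^esub> v\<close>.
\<close>

definition indep_sets :: "('a, 'b) pre_digraph \<Rightarrow> 'a set set" where
  "indep_sets G = {S. S \<subseteq> verts G \<and> pairwise (\<lambda>u v. \<not> u \<rightarrow>\<^bsub>G\<^esub> v) S}"

definition num_indep :: "('a, 'b) pre_digraph \<Rightarrow> nat" where
  "num_indep G = card (indep_sets G)"

definition total_indep :: "('a, 'b) pre_digraph \<Rightarrow> nat" where
  "total_indep G = (\<Sum>S\<in>indep_sets G. card S)"

definition avi :: "('a, 'b) pre_digraph \<Rightarrow> real" where
  "avi G = real (total_indep G) / real (num_indep G)"

end

theory Submission
  imports Defs
begin

text \<open>
  Deleting \<open>v\<close> lowers the average iff the independent sets containing \<open>v\<close> have average size above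
  \<open>avi G\<close>. If no vertex had this property, then summing over all vertices would give
  \<open>\<Sum>\<^sub>S |S|\<^sup>2 \<le> avi G * \<Sum>\<^sub>S |S|\<close>, so the variance of the size of a uniformly random independent set
  would vanish. This is impossible, as both the empty set and the singletons are independent.
\<close>

lemma indep_sets_del_vert:
  "indep_sets (pre_digraph.del_vert G v) = {S \<in> indep_sets G. v \<notin> S}"
proof -
  have adj: "x \<rightarrow>\<^bsub>pre_digraph.del_vert G v\<^esub> y \<longleftrightarrow> x \<rightarrow>\<^bsub>G\<^esub> y" if "x \<noteq> v" "y \<noteq> v" for x y
    using that by (auto simp: arcs_ends_def arc_to_ends_def pre_digraph.del_vert_simps)
  have "pairwise (\<lambda>x y. \<not> x \<rightarrow>\<^bsub>pre_digraph.del_vert G v\<^esub> y) S \<longleftrightarrow> pairwise (\<lambda>x y. \<not> x \<rightarrow>\<^bsub>G\<^esub> y) S"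
    if "v \<notin> S" for S
    using that adj unfolding pairwise_def by metis
  then show ?thesis
    by (auto simp: indep_sets_def pre_digraph.verts_del_vert)
qed

lemma (in fin_digraph) finite_indep_sets: "finite (indep_sets G)"
  by (rule finite_subset[of _ "Pow (verts G)"]) (auto simp: indep_sets_def)

lemma empty_in_indep_sets: "{} \<in> indep_sets G"
  by (simp add: indep_sets_def)

lemma singleton_in_indep_sets: "v \<in> verts G \<Longrightarrow> {v} \<in> indep_sets G"
  by (simp add: indep_sets_def)

text \<open>Double counting of the pairs \<open>v \<in> S\<close>: after swapping the sums, each
  \<open>S\<close> contributes \<open>f S\<close> once for each of its elements. It is applied both
  to the size of \<open>S\<close> and to the constant \<open>avi G\<close>.\<close>

lemma sum_over_members:
  fixes f :: "'a set \<Rightarrow> 'b::semiring_1"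
  assumes "finite V" "finite F" "\<And>S. S \<in> F \<Longrightarrow> S \<subseteq> V"
  shows "(\<Sum>v\<in>V. \<Sum>S | S \<in> F \<and> v \<in> S. f S) = (\<Sum>S\<in>F. of_nat (card S) * f S)"
proof -
  have "(\<Sum>v\<in>V. \<Sum>S | S \<in> F \<and> v \<in> S. f S) = (\<Sum>S\<in>F. \<Sum>v | v \<in> V \<and> v \<in> S. f S)"
    using assms(1,2) by (rule sum.swap_restrict)
  also have "\<dots> = (\<Sum>S\<in>F. of_nat (card S) * f S)"
  proof (rule sum.cong)
    fix S assume "S \<in> F"
    then have "{v. v \<in> V \<and> v \<in> S} = S" using assms(3) by auto
    then show "(\<Sum>v | v \<in> V \<and> v \<in> S. f S) = of_nat (card S) * f S" by simp
  qed simp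
  finally show ?thesis .
qed

text \<open>The mean over all independent sets is a weighted mean of the means over those containing
  \<open>v\<close> and those avoiding \<open>v\<close>, and the latter are the independent sets of
  \<open>G - v\<close>. If one part lies above the overall mean, the other lies below it. The
  product form of the hypothesis avoids a division by the number of sets containing
  \<open>v\<close>.\<close>

lemma (in fin_digraph) avi_del_vert_less:
  assumes "avi G * real (card {S \<in> indep_sets G. v \<in> S})
    < (\<Sum>S | S \<in> indep_sets G \<and> v \<in> S. real (card S))"
  shows "avi (del_vert v) < avi G"
proof -
  let ?with = "{S \<in> indep_sets G. v \<in> S}" and ?wo = "{S \<in> indep_sets G. v \<notin> S}"
  have partition: "indep_sets G = ?with \<union> ?wo" "?with \<inter> ?wo = {}" by auto
  have fin: "finite ?with" "finite ?wo" using finite_indep_sets by simp_all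
  \<comment> \<open>The empty set avoids \<open>v\<close>, so the divisions by
    \<open>card ?wo\<close> and by \<open>num_indep G\<close> are genuine.\<close>
  have wo_pos: "0 < card ?wo"
    using fin(2) empty_in_indep_sets by (auto simp: card_gt_0_iff)
  have "card (indep_sets G) = card ?with + card ?wo"
    using partition fin by (metis card_Un_disjoint)
  then have num: "real (num_indep G) = real (card ?with) + real (card ?wo)"
    by (simp add: num_indep_def)
  have "(\<Sum>S\<in>indep_sets G. card S) = (\<Sum>S\<in>?with. card S) + (\<Sum>S\<in>?wo. card S)"
    using partition fin by (metis (no_types, lifting) sum.union_disjoint)
  then have total: "real (total_indep G) = (\<Sum>S\<in>?with. real (card S)) + (\<Sum>S\<in>?wo. real (card S))"
    by (simp add: total_indep_def)
  have "avi G * real (num_indep G) = real (total_indep G)"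
    using num wo_pos by (simp add: avi_def)
  then have "(\<Sum>S\<in>?wo. real (card S)) < avi G * real (card ?wo)"
    using assms num total by (simp add: distrib_left)
  then show ?thesis
    using wo_pos
    by (simp add: avi_def[of "del_vert v"] total_indep_def num_indep_def indep_sets_del_vert
        pos_divide_less_eq)
qed

theorem corollary3p2:
  fixes G :: "('a, 'b) pre_digraph"
  assumes "graph G" and "verts G \<noteq> {}"
  shows "\<exists>v\<in>verts G. avi (pre_digraph.del_vert G v) < avi G"
proof (rule ccontr)
  interpret graph G by fact
  define F where "F = indep_sets G"
  define a where "a = avi G"
  have fin: "finite F" unfolding F_def by (rule finite_indep_sets)
  have sub: "S \<subseteq> verts G" if "S \<in> F" for S using that by (simp add: F_def indep_sets_def)
  obtain u where u: "u \<in> verts G" using assms(2) by blast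
  have total: "(\<Sum>S\<in>F. real (card S)) = a * real (card F)"
  proof -
    have "card F \<noteq> 0" using fin empty_in_indep_sets[of G] unfolding F_def card_eq_0_iff by blast
    then show ?thesis
      by (simp add: a_def avi_def total_indep_def num_indep_def flip: F_def)
  qed
  assume no_vertex: "\<not> (\<exists>v\<in>verts G. avi (pre_digraph.del_vert G v) < avi G)"
  \<comment> \<open>The bound \<open>a * card\<close> is written as a sum of the constant
    \<open>a\<close>, so that \<open>sum_over_members\<close> evaluates both sides after summation
    over \<open>v\<close>.\<close>
  have "(\<Sum>S | S \<in> F \<and> v \<in> S. real (card S)) \<le> (\<Sum>S | S \<in> F \<and> v \<in> S. a)"
    if "v \<in> verts G" for v
  proof -
    have "\<not> avi (del_vert v) < avi G" using no_vertex that by blast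
    then have "\<not> a * real (card {S \<in> F. v \<in> S}) < (\<Sum>S | S \<in> F \<and> v \<in> S. real (card S))"
      using avi_del_vert_less[of v] unfolding F_def a_def by blast
    then show ?thesis by (simp add: mult.commute)
  qed
  then have "(\<Sum>v\<in>verts G. \<Sum>S | S \<in> F \<and> v \<in> S. real (card S))
      \<le> (\<Sum>v\<in>verts G. \<Sum>S | S \<in> F \<and> v \<in> S. a)"
    by (rule sum_mono)
  then have "(\<Sum>S\<in>F. real (card S) * real (card S)) \<le> (\<Sum>S\<in>F. real (card S) * a)"
    by (simp only: sum_over_members[OF finite_verts fin sub])
  \<comment> \<open>The expanded square is grouped so that the difference of the first two sums is
    at most 0 by the inequality just shown, while the last sum vanishes because \<open>a\<close> is
    the mean size.\<close>
  moreover have "(\<Sum>S\<in>F. (real (card S) - a)\<^sup>2) = (\<Sum>S\<in>F. real (card S) * real (card S))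
      - (\<Sum>S\<in>F. real (card S) * a) + (\<Sum>S\<in>F. a * a - a * real (card S))"
    unfolding sum_subtractf[symmetric] sum.distrib[symmetric]
    by (simp add: power2_eq_square algebra_simps)
  ultimately have "(\<Sum>S\<in>F. (real (card S) - a)\<^sup>2) \<le> (\<Sum>S\<in>F. a * a - a * real (card S))"
    by linarith
  also have "\<dots> = 0"
    using total by (simp add: sum_subtractf flip: sum_distrib_left)
  finally have "(\<Sum>S\<in>F. (real (card S) - a)\<^sup>2) = 0"
    by (simp add: order_antisym sum_nonneg)
  then have const: "real (card S) = a" if "S \<in> F" for S
    using that fin by (simp add: sum_nonneg_eq_0_iff)
  have "{} \<in> F" "{u} \<in> F"
    unfolding F_def by (rule empty_in_indep_sets, rule singleton_in_indep_sets[OF u])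
  then show False
    using const[of "{}"] const[of "{u}"] by simp
qed

end
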